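(* Let $q$ be a prime power, $\mathbb{A}=\mathbb{F}_q[t]$, let $f\in\mathbb{A}$ be a non-constant polynomial of degree $n$, let $P\in\mathbb{A}$ be an irreducible polynomial of degree $d\ge1$, and let $e\ge 1$ be an integer. With the functions $B_k:\mathbb{A}_f\to\mathbb{A}_{P^e}$ ($k\ge 0$) defined in the context, a function $\sigma:\mathbb{A}_f\to\mathbb{A}_{P^e}$ is congruence preserving if and only if there is a unique sequence $\{c_0,c_1,\dots,c_{q^n-1}\}$ of elements of $\mathbb{A}_{P^e}$ such that $$\sigma=\sum_{k=0}^{q^n-1}c_kB_k,$$ and for each $k=1,\dots,q^n-1$, $c_k$ is in the subgroup generated by $P^{\mu(k)}\pmod{P^e}$, where $\mu(k)=\left\lfloor\frac{\log_q k}{d}\right\rfloor$.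
   Context: $\mathbb{F}_q$ is the finite field with $q$ elements and $\mathbb{A}=\mathbb{F}_q[t]$. For a non-constant $f\in\mathbb{A}$, $\mathbb{A}_f=\mathbb{A}/f\mathbb{A}$ is the residue class ring modulo $f$, and $\mathcal{A}_f=\{h\in\mathbb{A}:\deg h<\deg f\}\cup\{0\}$, a complete set of representatives of the residue classes modulo $f$; for $h\in\mathcal{A}_f$, $\bar h$ denotes the residue class of $h$ modulo $f$. For non-constant $f,g\in\mathbb{A}$, a function $\sigma:\mathbb{A}_f\to\mathbb{A}_g$ is called congruence preserving if for all $h_1,h_2\in\mathcal{A}_f$ and every $h\in\mathbb{A}$ dividing $g$, $h_1\equiv h_2\pmod h$ implies $\sigma(\bar h_1)\equiv\sigma(\bar h_2)\pmod h$ (here $h_1,h_2$ are regarded as elements of $\mathbb{A}$, and reduction modulo $h$ of elements of $\mathbb{A}_g$ is well defined since $h\mid g$). Let $P$ be irreducible of degree $d$. Fix an ordering $b_0,b_1,\dots,b_{q^d-1}$ of all polynomials in $\mathbb{A}$ of degree less than $d$ (including $0$) such that $b_0=0$, $b_1=1$ and $\deg b_i\le\deg b_j$ for $1\le i\le j\le q^d-1$. For every $k\in\mathbb{N}=\{0,1,2,\dots\}$ with $q^d$-adic expansion $k=\sum_{i=0}^m l_iq^{di}$ ($0\le l_i<q^d$), put $b_k=b_{l_0}+b_{l_1}P+\dots+b_{l_m}P^m$. Define polynomials over $\mathbb{F}_q(t)$ by $$Q_0(x)=1,\qquad Q_k(x)=\frac{\prod_{j=0}^{k-1}(x-b_j)}{\prod_{j=0}^{k-1}(b_k-b_j)}\quad(k>0).$$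 It is a known fact (Wagner) that for all $k\in\mathbb{N}$ and $h\in\mathbb{A}$, $Q_k(h)$ has non-negative valuation at $P$, so its reduction modulo $P^e$ is a well-defined element of $\mathbb{A}_{P^e}$. The function $B_k:\mathbb{A}_f\to\mathbb{A}_{P^e}$ is defined by $B_k(\bar h)=Q_k(h)\bmod P^e$ for $h\in\mathcal{A}_f$.
   Formalization: "Subgroup generated by P^μ(k)" is taken as the ideal of all multiples of P^μ(k) in A_{P^e}; with the cyclic additive subgroup the claim fails (q=2, f=P=t, e=2, σ(0)=0, σ(1)=t gives c_1=t, not in {0,1}). *)

theory Defs
  imports
    "HOL-Algebra.Algebraic_Closure_Type"
    "HOL-Number_Theory.Cong"
    "HOL-Computational_Algebra.Computational_Algebra"
    "HOL-Library.Cardinality"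
begin

text \<open>
  The field with \<open>q\<close> elements is a type \<open>'a :: {field, finite}\<close> with \<open>q = CARD('a)\<close>,
  and \<open>\<bbbA>\<close> is the type \<open>'a poly\<close>.
\<close>

definition residue_ring_poly :: "'a::field poly \<Rightarrow> 'a poly set ring"
  where "residue_ring_poly f =
    ring_of_type_algebra Quot (PIdl\<^bsub>ring_of_type_algebra\<^esub> f)"

definition residue_class :: "'a::field poly \<Rightarrow> 'a poly \<Rightarrow> 'a poly set"
  where "residue_class f h =
    (PIdl\<^bsub>ring_of_type_algebra\<^esub> f) +>\<^bsub>ring_of_type_algebra\<^esub> h"

definition representatives :: "'a::field poly \<Rightarrow> 'a poly set"
  where "representatives f = {h. degree h < degree f} \<union> {0}"

definition representative :: "'a::field poly \<Rightarrow> 'a poly set \<Rightarrow> 'a poly"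
  where "representative f U = (THE h. h \<in> representatives f \<and> residue_class f h = U)"

text \<open>
  Congruence modulo \<open>h\<close> of two residue classes modulo \<open>g\<close>, used for \<open>h dvd g\<close> only; it then
  does not depend on the elements chosen in the (nonempty) classes.
\<close>

definition class_cong :: "'a::field poly \<Rightarrow> 'a poly set \<Rightarrow> 'a poly set \<Rightarrow> bool"
  where "class_cong h U V \<longleftrightarrow> (\<forall>u\<in>U. \<forall>v\<in>V. [u = v] (mod h))"

definition congruence_preserving ::
  "'a::field poly \<Rightarrow> 'a poly \<Rightarrow> ('a poly set \<Rightarrow> 'a poly set) \<Rightarrow> bool"
  where "congruence_preserving f g \<sigma> \<longleftrightarrow>
    (\<forall>h1\<in>representatives f. \<forall>h2\<in>representatives f. \<forall>h. h dvd g \<longrightarrow>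
       [h1 = h2] (mod h) \<longrightarrow>
       class_cong h (\<sigma> (residue_class f h1)) (\<sigma> (residue_class f h2)))"

text \<open>Only the values \<open>\<beta> i\<close> with \<open>i < q ^ d\<close> are relevant.\<close>

definition admissible_ordering :: "nat \<Rightarrow> (nat \<Rightarrow> 'a::{field,finite} poly) \<Rightarrow> bool"
  where "admissible_ordering d \<beta> \<longleftrightarrow>
    bij_betw \<beta> {..<CARD('a) ^ d} ({h. degree h < d} \<union> {0}) \<and>
    \<beta> 0 = 0 \<and> \<beta> 1 = 1 \<and>
    (\<forall>i j. 1 \<le> i \<longrightarrow> i \<le> j \<longrightarrow> j \<le> CARD('a) ^ d - 1 \<longrightarrow> degree (\<beta> i) \<le> degree (\<beta> j))"

text \<open>
  The \<open>i\<close>-th digit of \<open>k\<close> in base \<open>N = q ^ d\<close> is \<open>k div N ^ i mod N\<close>.  All digits of index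
  greater than \<open>k\<close> are zero, and zero digits contribute nothing since \<open>\<beta> 0 = 0\<close>.
\<close>

definition digit_poly ::
  "(nat \<Rightarrow> 'a::{field,finite} poly) \<Rightarrow> 'a poly \<Rightarrow> nat \<Rightarrow> 'a poly"
  where "digit_poly \<beta> P k =
    (let N = CARD('a) ^ degree P in \<Sum>i\<le>k. \<beta> (k div N ^ i mod N) * P ^ i)"

definition wagner_poly ::
  "(nat \<Rightarrow> 'a::{field,finite} poly) \<Rightarrow> 'a poly \<Rightarrow> nat \<Rightarrow> 'a poly fract poly"
  where "wagner_poly \<beta> P k =
    smult (1 / (\<Prod>j<k. to_fract (digit_poly \<beta> P k) - to_fract (digit_poly \<beta> P j)))
          (\<Prod>j<k. [:- to_fract (digit_poly \<beta> P j), 1:])"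

text \<open>The elements of \<open>\<bbbF>\<^sub>q(t)\<close> with non-negative valuation at \<open>P\<close>.\<close>

definition local_integers :: "'a::field poly \<Rightarrow> 'a poly fract set"
  where "local_integers P = {Fract a b | a b. \<not> P dvd b}"

text \<open>
  Reduction modulo \<open>P ^ e\<close> of an element \<open>x\<close> of \<open>local_integers P\<close>: the class of all
  polynomials congruent to \<open>x\<close> modulo \<open>P ^ e\<close> in \<open>local_integers P\<close>.
\<close>

definition reduce_mod :: "'a::field poly \<Rightarrow> nat \<Rightarrow> 'a poly fract \<Rightarrow> 'a poly set"
  where "reduce_mod P e x =
    {r. \<exists>y\<in>local_integers P. x - to_fract r = to_fract (P ^ e) * y}"

definition wagner_fun ::
  "(nat \<Rightarrow> 'a::{field,finite} poly) \<Rightarrow> 'a poly \<Rightarrow> 'a poly \<Rightarrow> nat \<Rightarrow> nat \<Rightarrow>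
    'a poly set \<Rightarrow> 'a poly set"
  where "wagner_fun \<beta> f P e k U =
    reduce_mod P e (poly (wagner_poly \<beta> P k) (to_fract (representative f U)))"

lemma mem_residue_class_iff: "g \<in> residue_class f h \<longleftrightarrow> [g = h] (mod f)"
proof -
  have "g \<in> residue_class f h \<longleftrightarrow> (\<exists>x. g = x * f + h)"
    by (auto simp: residue_class_def a_r_coset_def r_coset_def cgenideal_def
        ring_of_type_algebra_def)
  also have "\<dots> \<longleftrightarrow> f dvd g - h"
    by (metis add_diff_cancel_right' diff_add_cancel dvd_def mult.commute)
  finally show ?thesis
    by (simp add: cong_iff_dvd_diff)
qed

lemma reduce_mod_Fract:
  assumes "irreducible P" "\<not> P dvd b" "[b * r = a] (mod P ^ e)"
  shows "reduce_mod P e (Fract a b) = residue_class (P ^ e) r"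
proof -
  have b0: "b \<noteq> 0" using assms(2) by auto
  have pP: "prime_elem P"
    using assms(1) by (rule field_poly_irreducible_imp_prime)
  have P0: "P \<noteq> 0" using pP by auto
  have cop: "P ^ e dvd u" if "P ^ e dvd c * u" "\<not> P dvd c" for c u
    using that
  proof (induction e arbitrary: u)
    case (Suc e)
    have "P dvd c * u" using Suc.prems(1) by (metis dvd_mult_left power_Suc)
    then obtain w where w: "u = P * w"
      using Suc.prems(2) pP by (auto simp: prime_elem_dvd_mult_iff)
    have "P * P ^ e dvd P * (c * w)"
      using Suc.prems(1) by (simp add: w mult.left_commute)
    hence "P ^ e dvd c * w" using P0 by (subst (asm) dvd_mult_cancel_left) auto
    hence "P ^ e dvd w" using Suc.IH Suc.prems(2) by blast
    thus ?case unfolding w power_Suc by (rule mult_dvd_mono[OF dvd_refl])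
  qed simp
  have "s \<in> reduce_mod P e (Fract a b) \<longleftrightarrow> P ^ e dvd a - b * s" for s
  proof
    assume "s \<in> reduce_mod P e (Fract a b)"
    then obtain u v where uv: "\<not> P dvd v"
      "Fract a b - to_fract s = to_fract (P ^ e) * Fract u v"
      by (auto simp: reduce_mod_def local_integers_def)
    have "v \<noteq> 0" using uv by auto
    hence "(a - b * s) * v = b * (P ^ e * u)"
      using uv(2) b0 by (simp add: to_fract_def eq_fract mult.commute)
    hence "P ^ e dvd v * (a - b * s)"
      by (metis dvd_triv_left mult.commute mult.left_commute)
    thus "P ^ e dvd a - b * s" using cop uv(1) by blast
  next
    assume "P ^ e dvd a - b * s"
    then obtain u where "a - b * s = P ^ e * u" by blast
    hence "Fract a b - to_fract s = to_fract (P ^ e) * Fract u b"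
      using b0 by (simp add: to_fract_def eq_fract mult.commute)
    thus "s \<in> reduce_mod P e (Fract a b)"
      using assms(2) by (auto simp: reduce_mod_def local_integers_def)
  qed
  moreover have "P ^ e dvd a - b * s \<longleftrightarrow> [s = r] (mod P ^ e)" for s
  proof -
    have 1: "P ^ e dvd b * r - a" using assms(3) by (simp add: cong_iff_dvd_diff)
    have 2: "b * (s - r) = - (a - b * s) - (b * r - a)" by (simp add: algebra_simps)
    have "P ^ e dvd a - b * s \<longleftrightarrow> P ^ e dvd - (a - b * s) - (b * r - a)"
      by (simp only: dvd_diff_left_iff[OF 1] dvd_minus_iff)
    also have "\<dots> \<longleftrightarrow> P ^ e dvd b * (s - r)" unfolding 2 ..
    also have "\<dots> \<longleftrightarrow> P ^ e dvd s - r"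
      using cop[OF _ assms(2)] dvd_mult by blast
    finally show ?thesis by (simp add: cong_iff_dvd_diff)
  qed
  ultimately show ?thesis by (auto simp: mem_residue_class_iff)
qed

end

theory Submission
  imports Defs
begin

text \<open>
  The matrix \<open>(Q\<^sub>k(b\<^sub>i))\<close> is unitriangular and \<open>b\<^sub>0, b\<^sub>1, \<dots>\<close> runs through the polynomials of degree
  less than \<open>n\<close> for indices below \<open>q ^ n\<close>, so every function has exactly one expansion. Writing
  \<open>N = q ^ d\<close>, one has \<open>P ^ t dvd b\<^sub>j - b\<^sub>k\<close> iff \<open>j = k\<close> modulo \<open>N ^ t\<close>; hence the denominator of \<open>Q\<^sub>k\<close> has
  valuation \<open>\<Sum>\<^sub>t (k div N ^ t)\<close>, and counting residues shows that
  \<open>P ^ \<mu>(k) * (Q\<^sub>k(h) - Q\<^sub>k(h'))\<close> is divisible by every power of \<open>P\<close> dividing \<open>h - h'\<close>. So each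
  term \<open>c\<^sub>k B\<^sub>k\<close> with \<open>P ^ \<mu>(k)\<close> dividing \<open>c\<^sub>k\<close> is congruence preserving. The converse is an induction on
  \<open>k\<close>, which compares the values at \<open>b\<^sub>k\<close> and \<open>b\<^sub>r\<close> for \<open>r = k mod N ^ \<mu>(k)\<close>.
\<close>

subsection \<open>Divisibility and counting\<close>

text \<open>\<open>pCons\<close> splits off the constant coefficient, which gives a factor
  \<open>CARD('a)\<close> at each step. Listing 0 separately keeps the count right at
  \<open>n = 0\<close>, where no polynomial satisfies the degree bound.\<close>

lemma card_poly_degree_less:
  "finite {h :: 'a::{field,finite} poly. degree h < n \<or> h = 0}"
  "card {h :: 'a poly. degree h < n \<or> h = 0} = CARD('a) ^ n"
proof -
  let ?S = "\<lambda>n. {h :: 'a poly. degree h < n \<or> h = 0}"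
  have "finite (?S n) \<and> card (?S n) = CARD('a) ^ n"
  proof (induction n)
    case (Suc n)
    have eq: "?S (Suc n) = (\<lambda>(a, p). pCons a p) ` (UNIV \<times> ?S n)" (is "_ = ?R")
    proof (intro equalityI subsetI)
      fix h assume "h \<in> ?S (Suc n)"
      moreover obtain a p where "h = pCons a p" by (cases h)
      ultimately show "h \<in> ?R" by (auto split: if_splits)
    qed (auto split: if_splits)
    have "inj_on (\<lambda>(a, p :: 'a poly). pCons a p) (UNIV \<times> ?S n)"
      by (auto simp: inj_on_def)
    then show ?case
      unfolding eq using Suc by (simp add: card_image card_cartesian_product)
  qed simp
  then show "finite (?S n)" "card (?S n) = CARD('a) ^ n" by auto
qed

text \<open>Up to units the only divisors of \<open>p ^ e\<close> are powers of \<open>p\<close>: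
  either a factor \<open>p\<close> can be cancelled from \<open>h\<close>, or \<open>p\<close>
  divides the cofactor and \<open>e\<close> drops by one. This reduces congruences modulo all
  divisors to congruences modulo powers.\<close>

lemma dvd_prime_elem_power:
  fixes p :: "'a::idom"
  assumes "prime_elem p" "h dvd p ^ e"
  obtains i where "i \<le> e" "h dvd p ^ i" "p ^ i dvd h"
proof -
  have "\<exists>i\<le>e. h dvd p ^ i \<and> p ^ i dvd h"
    using assms(2)
  proof (induction e arbitrary: h)
    case 0
    then show ?case by simp
  next
    case (Suc e)
    have p0: "p \<noteq> 0" using assms(1) by auto
    show ?case
    proof (cases "p dvd h")
      case True
      then obtain h' where h: "h = p * h'" by blast
      with Suc.prems p0 have "h' dvd p ^ e" by simp
      from Suc.IH[OF this] obtain i where "i \<le> e" "h' dvd p ^ i" "p ^ i dvd h'" by blast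
      with h have "Suc i \<le> Suc e \<and> h dvd p ^ Suc i \<and> p ^ Suc i dvd h"
        by (simp add: mult_dvd_mono)
      then show ?thesis by blast
    next
      case False
      from Suc.prems obtain w where w: "p ^ Suc e = h * w" by blast
      then have "p dvd h * w" by (metis dvd_triv_left power_Suc)
      with False assms(1) obtain w' where "w = p * w'"
        by (auto simp: prime_elem_dvd_mult_iff)
      with w p0 have "p ^ e = h * w'" by (simp add: mult.left_commute)
      with Suc.IH[of h] show ?thesis by (auto intro: le_SucI)
    qed
  qed
  with that show thesis by blast
qed

lemma prime_elem_dvd_prod:
  assumes "prime_elem p" "finite A" "p dvd prod f A"
  shows "\<exists>x\<in>A. p dvd f x"
  using assms(2,3,1)
  by (induction A rule: finite_induct) (auto simp: prime_elem_dvd_mult_iff prime_elem_not_unit)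

text \<open>Exact valuations add up: the parts prime to \<open>p\<close> have a product prime to
  \<open>p\<close>, since \<open>p\<close> is a prime element.\<close>

lemma prod_eq_power_times:
  fixes p :: "'a::idom"
  assumes "prime_elem p" "finite A"
    and "\<And>x. x \<in> A \<Longrightarrow> p ^ c x dvd f x \<and> \<not> p ^ Suc (c x) dvd f x"
  obtains u where "prod f A = p ^ sum c A * u" "\<not> p dvd u"
proof -
  have "\<forall>x\<in>A. \<exists>v. f x = p ^ c x * v \<and> \<not> p dvd v"
  proof
    fix x assume "x \<in> A"
    from assms(3)[OF this] obtain v where v: "f x = p ^ c x * v" and n: "\<not> p ^ Suc (c x) dvd f x"
      by blast
    then have "\<not> p dvd v"
      by (auto simp: mult.commute intro: mult_dvd_mono)
    with v show "\<exists>v. f x = p ^ c x * v \<and> \<not> p dvd v" by blast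
  qed
  then obtain v where v: "\<And>x. x \<in> A \<Longrightarrow> f x = p ^ c x * v x \<and> \<not> p dvd v x"
    by metis
  have "prod f A = p ^ sum c A * prod v A"
    using v by (simp add: prod.distrib power_sum)
  moreover have "\<not> p dvd prod v A"
    using prime_elem_dvd_prod[OF assms(1,2), of v] v by blast
  ultimately show thesis using that by blast
qed

text \<open>Each of the \<open>k div M\<close> complete blocks of length \<open>M\<close> below
  \<open>k\<close> contains one member of the class of \<open>c\<close>.\<close>

lemma card_lessThan_mod_ge:
  fixes k M c :: nat
  assumes "c < M"
  shows "k div M \<le> card {j. j < k \<and> j mod M = c}"
proof -
  have "inj_on (\<lambda>i. i * M + c) {..<k div M}" using assms by (auto simp: inj_on_def)
  moreover have "i * M + c < k" if "i < k div M" for i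
  proof -
    have "i * M + c < Suc i * M" using assms by simp
    also have "\<dots> \<le> (k div M) * M" using that by (intro mult_le_mono1) simp
    also have "\<dots> \<le> k" by simp
    finally show ?thesis .
  qed
  then have "(\<lambda>i. i * M + c) ` {..<k div M} \<subseteq> {j. j < k \<and> j mod M = c}" using assms by auto
  ultimately have "card {..<k div M} \<le> card {j. j < k \<and> j mod M = c}"
    by (intro card_inj_on_le) auto
  then show ?thesis by simp
qed

text \<open>For the class of \<open>k\<close> itself the incomplete last block adds nothing, because
  its member of that class would be \<open>k\<close>.\<close>

lemma card_lessThan_mod_eq:
  fixes k M :: nat
  assumes "M > 0"
  shows "card {j. j < k \<and> j mod M = k mod M} = k div M"
proof -
  have "{j. j < k \<and> j mod M = k mod M} = (\<lambda>i. i * M + k mod M) ` {..<k div M}"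
  proof (intro equalityI subsetI)
    fix j assume j: "j \<in> {j. j < k \<and> j mod M = k mod M}"
    then have "j = (j div M) * M + k mod M" using div_mult_mod_eq[of j M] by (simp only: mem_Collect_eq)
    moreover have "j div M < k div M"
    proof (rule ccontr)
      assume "\<not> j div M < k div M"
      then have "(k div M) * M \<le> (j div M) * M" by (intro mult_le_mono1) simp
      then have "(k div M) * M + k mod M \<le> (j div M) * M + j mod M"
        using j by (simp only: mem_Collect_eq add_le_cancel_right)
      then have "k \<le> j" by (simp only: div_mult_mod_eq)
      then show False using j by simp
    qed
    ultimately show "j \<in> (\<lambda>i. i * M + k mod M) ` {..<k div M}" by blast
  next
    fix j assume "j \<in> (\<lambda>i. i * M + k mod M) ` {..<k div M}"
    then obtain i where i: "i < k div M" "j = i * M + k mod M" by blast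
    have "i * M < (k div M) * M" using i(1) assms by (rule mult_less_mono1)
    then have "i * M + k mod M < (k div M) * M + k mod M" by (rule add_strict_right_mono)
    then have "j < k" by (simp only: i(2) div_mult_mod_eq)
    then show "j \<in> {j. j < k \<and> j mod M = k mod M}" using i by simp
  qed
  moreover have "inj_on (\<lambda>i. i * M + k mod M) {..<k div M}" using assms by (auto simp: inj_on_def)
  ultimately show ?thesis by (simp add: card_image)
qed

text \<open>The exponents counted form an initial segment \<open>{1..M}\<close>, so the cardinality
  is the valuation of \<open>x\<close> cut off at \<open>m\<close>. It is the exact valuation as
  soon as \<open>p ^ Suc m\<close> does not divide \<open>x\<close>.\<close>

lemma power_card_dvd:
  fixes p x :: "'a::idom"
  shows "p ^ card {t\<in>{1..m}. p ^ t dvd x} dvd x"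
    and "\<not> p ^ Suc m dvd x \<Longrightarrow> \<not> p ^ Suc (card {t\<in>{1..m}. p ^ t dvd x}) dvd x"
proof -
  obtain M where M: "{t\<in>{1..m}. p ^ t dvd x} = {1..M}" "M \<le> m"
  proof -
    define S where "S = {t\<in>{1..m}. p ^ t dvd x}"
    define M where "M = (if S = {} then 0 else Max S)"
    have fin: "finite S" unfolding S_def by simp
    have "M = 0 \<or> M \<in> S"
      unfolding M_def using Max_in[OF fin] by simp
    moreover have le: "t \<le> M" if "t \<in> S" for t
      using Max_ge[OF fin that] that by (auto simp: M_def)
    ultimately have "{1..M} \<subseteq> S" "M \<le> m"
      using power_le_dvd[of p M x] by (auto simp: S_def)
    with le have "{t\<in>{1..m}. p ^ t dvd x} = {1..M}" "M \<le> m" by (auto simp: S_def)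
    with that show thesis by blast
  qed
  then have card: "card {t\<in>{1..m}. p ^ t dvd x} = M" by simp
  show "p ^ card {t\<in>{1..m}. p ^ t dvd x} dvd x"
  proof (cases "M = 0")
    case False
    then have "M \<in> {1..M}" by simp
    then have "p ^ M dvd x" by (simp only: M(1)[symmetric] mem_Collect_eq)
    with card show ?thesis by (simp only:)
  next
    case True
    then show ?thesis by (simp only: card) simp
  qed
  assume n: "\<not> p ^ Suc m dvd x"
  show "\<not> p ^ Suc (card {t\<in>{1..m}. p ^ t dvd x}) dvd x"
  proof
    assume a: "p ^ Suc (card {t\<in>{1..m}. p ^ t dvd x}) dvd x"
    then have a': "p ^ Suc M dvd x" by (simp only: card)
    with n have "M \<noteq> m" by (intro notI) (simp only:)
    with a' M(2) have "Suc M \<in> {t\<in>{1..m}. p ^ t dvd x}" by simp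
    then have "Suc M \<in> {1..M}" by (simp only: M(1))
    then show False by simp
  qed
qed

text \<open>Double counting as in Legendre's formula: a sum of valuations over the factors becomes,
  for each exponent, the number of factors divisible by that power.\<close>

lemma sum_card_swap:
  assumes "finite A" "finite B"
  shows "(\<Sum>x\<in>A. card {y\<in>B. R x y}) = (\<Sum>y\<in>B. card {x\<in>A. R x y})"
  using sum.swap_restrict[OF assms, of "\<lambda>_ _. 1::nat" R] by simp

lemma prime_elem_power_dvd_mult_cancel:
  fixes p :: "'a::idom"
  assumes "prime_elem p" "\<not> p dvd u" "p ^ e dvd u * x"
  shows "p ^ e dvd x"
  using assms(3)
proof (induction e arbitrary: x)
  case (Suc e)
  have p0: "p \<noteq> 0" using assms(1) by auto
  have "p dvd u * x" using Suc.prems by (metis dvd_mult_left power_Suc)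
  then obtain y where y: "x = p * y"
    using assms(1,2) by (auto simp: prime_elem_dvd_mult_iff)
  have "p * p ^ e dvd p * (u * y)" using Suc.prems by (simp add: y mult.left_commute)
  then have "p ^ e dvd u * y" using p0 by simp
  from mult_dvd_mono[OF dvd_refl Suc.IH[OF this]] show ?case by (simp only: y power_Suc)
qed simp

lemma to_fract_prod: "to_fract (prod f A) = (\<Prod>x\<in>A. to_fract (f x))"
  by (induction A rule: infinite_finite_induct) simp_all

subsection \<open>The sequence of digit polynomials\<close>

locale wagner_basis =
  fixes \<beta> :: "nat \<Rightarrow> 'a::{field,finite} poly" and P :: "'a poly"
  assumes irreducible_P: "irreducible P"
    and ordering: "admissible_ordering (degree P) \<beta>"
begin

abbreviation N :: nat where "N \<equiv> CARD('a) ^ degree P"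

abbreviation b :: "nat \<Rightarrow> 'a poly" where "b \<equiv> digit_poly \<beta> P"

lemma prime_P: "prime_elem P"
  using irreducible_P by (rule field_poly_irreducible_imp_prime)

lemma P_nonzero: "P \<noteq> 0"
  using prime_P by auto

lemma degree_P_pos: "degree P > 0"
  using prime_elem_not_unit[OF prime_P] is_unit_iff_degree[OF P_nonzero] by auto

lemma two_le_card: "2 \<le> CARD('a)"
proof -
  have "card {0, 1 :: 'a} \<le> CARD('a)" by (rule card_mono) auto
  then show ?thesis by simp
qed

lemma two_le_N: "2 \<le> N"
  using two_le_card degree_P_pos power_increasing[of 1 "degree P" "CARD('a)"] by simp

lemma less_N_power: "k < N ^ k"
  using two_le_N by (meson less_exp less_le_trans power_mono zero_le)

lemma digit_bij: "bij_betw \<beta> {..<N} ({h. degree h < degree P} \<union> {0})"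
  and digit_0: "\<beta> 0 = 0"
  and digit_degree_mono: "1 \<le> i \<Longrightarrow> i \<le> j \<Longrightarrow> j < N \<Longrightarrow> degree (\<beta> i) \<le> degree (\<beta> j)"
  using ordering unfolding admissible_ordering_def by auto

lemma digit_degree: "i < N \<Longrightarrow> degree (\<beta> i) < degree P"
  using bspec[OF bij_betwE[OF digit_bij], of i] degree_P_pos by auto

lemma digit_inj: "i < N \<Longrightarrow> j < N \<Longrightarrow> \<beta> i = \<beta> j \<longleftrightarrow> i = j"
  using digit_bij unfolding bij_betw_def inj_on_def by auto

lemma digit_surj: "degree h < degree P \<Longrightarrow> \<exists>i<N. h = \<beta> i"
  using digit_bij unfolding bij_betw_def by (auto simp: image_iff)

text \<open>The ordering is by degree: if \<open>\<beta> l\<close> had degree at least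
  \<open>r\<close>, all \<open>CARD('a) ^ r\<close> polynomials of smaller degree would have to
  occur at indices below \<open>l\<close>.\<close>

lemma digit_degree_less:
  assumes "r \<le> degree P" "l < CARD('a) ^ r"
  shows "degree (\<beta> l) < r \<or> \<beta> l = 0"
proof (rule ccontr)
  assume neg: "\<not> ?thesis"
  have "CARD('a) ^ r \<le> N"
    using assms(1) two_le_card by (intro power_increasing) auto
  with assms(2) have "l < N" by simp
  have "l \<ge> 1" using neg digit_0 by (cases l) auto
  have "{h :: 'a poly. degree h < r \<or> h = 0} \<subseteq> \<beta> ` {..<l}"
  proof
    fix h :: "'a poly" assume h: "h \<in> {h. degree h < r \<or> h = 0}"
    then have "degree h < degree P" using assms(1) degree_P_pos by auto
    then obtain i where i: "i < N" "h = \<beta> i" using digit_surj by blast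
    have "i < l"
    proof (rule ccontr)
      assume "\<not> i < l"
      then have "degree (\<beta> l) \<le> degree (\<beta> i)"
        using digit_degree_mono \<open>l \<ge> 1\<close> i(1) by simp
      moreover have "\<beta> i \<noteq> 0"
        using digit_inj[of i 0] i(1) \<open>\<not> i < l\<close> \<open>l \<ge> 1\<close> two_le_N digit_0 by simp
      ultimately show False using h i(2) neg by auto
    qed
    then show "h \<in> \<beta> ` {..<l}" using i(2) by blast
  qed
  then have "CARD('a) ^ r \<le> card (\<beta> ` {..<l})"
    using card_mono[of "\<beta> ` {..<l}" "{h :: 'a poly. degree h < r \<or> h = 0}"]
    by (simp only: card_poly_degree_less) simp
  also have "\<dots> \<le> l" using card_image_le[of "{..<l}" \<beta>] by simp
  finally show False using assms(2) by simp
qed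

text \<open>Horner's scheme: splitting off the lowest digit makes induction on the number of digits
  possible.\<close>

lemma b_rec: "b k = \<beta> (k mod N) + P * b (k div N)"
proof (cases k)
  case 0
  then show ?thesis by (simp add: digit_poly_def Let_def digit_0)
next
  case (Suc k')
  \<comment> \<open>Digit positions above \<open>j\<close> itself are empty, so the summation range
    can shrink from \<open>k'\<close> to \<open>k div N\<close>.\<close>
  have zero: "\<beta> (j div N ^ i mod N) = 0" if "j < i" for i j
  proof -
    have "j < N ^ i" using that less_N_power[of i] by simp
    then show ?thesis by (simp add: digit_0)
  qed
  have "k div N < k" using two_le_N Suc by (intro div_less_dividend) auto
  then have le: "k div N \<le> k'" using Suc by simp
  have "b k = (\<Sum>i\<le>Suc k'. \<beta> (k div N ^ i mod N) * P ^ i)"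
    by (simp add: digit_poly_def Let_def Suc)
  also have "\<dots> = \<beta> (k mod N) + (\<Sum>i\<le>k'. \<beta> (k div N ^ Suc i mod N) * P ^ Suc i)"
    by (subst sum.atMost_Suc_shift) simp
  also have "(\<Sum>i\<le>k'. \<beta> (k div N ^ Suc i mod N) * P ^ Suc i) =
      P * (\<Sum>i\<le>k'. \<beta> (k div N div N ^ i mod N) * P ^ i)"
    by (simp add: sum_distrib_left div_mult2_eq mult.left_commute)
  also have "(\<Sum>i\<le>k'. \<beta> (k div N div N ^ i mod N) * P ^ i) =
      (\<Sum>i\<le>k div N. \<beta> (k div N div N ^ i mod N) * P ^ i)"
    using le by (intro sum.mono_neutral_right) (auto simp: zero)
  also have "\<dots> = b (k div N)" by (simp add: digit_poly_def Let_def)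
  finally show ?thesis .
qed

text \<open>Distinct digits have a nonzero difference of degree below \<open>degree P\<close>, so
  divisibility by \<open>P\<close> forces equal lowest digits. Removing them and cancelling
  \<open>P\<close> lowers \<open>t\<close>.\<close>

lemma b_cong_iff: "P ^ t dvd b j - b k \<longleftrightarrow> j mod N ^ t = k mod N ^ t"
proof (induction t arbitrary: j k)
  case (Suc t)
  have N0: "N > 0" using two_le_N by simp
  have diff: "b j - b k = (\<beta> (j mod N) - \<beta> (k mod N)) + P * (b (j div N) - b (k div N))"
    by (subst (1 2) b_rec) (simp add: algebra_simps)
  have modS: "n mod N ^ Suc t = N * (n div N mod N ^ t) + n mod N" for n
    by (simp add: mod_mult2_eq)
  show ?case
  proof
    assume a: "P ^ Suc t dvd b j - b k"
    then have "P dvd b j - b k" by (metis dvd_mult_left power_Suc)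
    then have "P dvd \<beta> (j mod N) - \<beta> (k mod N)"
      unfolding diff by (simp add: dvd_add_left_iff)
    moreover have "degree (\<beta> (j mod N) - \<beta> (k mod N)) < degree P"
      using N0 by (intro degree_diff_less digit_degree) simp_all
    ultimately have "\<beta> (j mod N) - \<beta> (k mod N) = 0"
      using dvd_imp_degree_le leD by blast
    then have jk: "j mod N = k mod N" using digit_inj N0 by simp
    then have "P ^ t dvd b (j div N) - b (k div N)"
      using a P_nonzero unfolding diff by simp
    with jk show "j mod N ^ Suc t = k mod N ^ Suc t"
      by (simp only: modS Suc.IH)
  next
    assume a: "j mod N ^ Suc t = k mod N ^ Suc t"
    have m: "n mod N ^ Suc t mod N = n mod N" "n mod N ^ Suc t div N = n div N mod N ^ t" for n
      unfolding modS using N0 by simp_all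
    have "j mod N = k mod N" "j div N mod N ^ t = k div N mod N ^ t"
      using a m[of j] m[of k] by (simp_all only:)
    then show "P ^ Suc t dvd b j - b k"
      unfolding diff using Suc.IH by (simp add: mult_dvd_mono)
  qed
qed simp

text \<open>Repeated division by \<open>P\<close> produces the digits. Together with
  \<open>b_cong_iff\<close>, the first \<open>N ^ t\<close> values of \<open>b\<close> form a
  complete residue system modulo \<open>P ^ t\<close>.\<close>

lemma ex_b_cong: "\<exists>j<N ^ t. P ^ t dvd h - b j"
proof (induction t arbitrary: h)
  case (Suc t)
  have N0: "N > 0" using two_le_N by simp
  have "degree (h mod P) < degree P"
    using degree_mod_less[OF P_nonzero, of h] degree_P_pos by auto
  then obtain l where l: "l < N" "h mod P = \<beta> l" using digit_surj by blast
  obtain j where j: "j < N ^ t" "P ^ t dvd h div P - b j" using Suc.IH by blast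
  have "b (j * N + l) = \<beta> l + P * b j"
    using l(1) by (subst b_rec) simp
  moreover have "h = P * (h div P) + \<beta> l" using l(2) by (metis mult_div_mod_eq)
  ultimately have "h - b (j * N + l) = P * (h div P - b j)"
    by (metis (no_types, lifting) add_diff_cancel_right add.commute right_diff_distrib)
  then have "P ^ Suc t dvd h - b (j * N + l)" using j(2) by (simp add: mult_dvd_mono)
  moreover have "j * N + l < N ^ Suc t"
  proof -
    have "j * N + l < Suc j * N" using l(1) by simp
    also have "\<dots> \<le> N ^ t * N" using j(1) by (intro mult_le_mono1) simp
    finally show ?thesis by (simp add: mult.commute)
  qed
  ultimately show ?case by blast
qed simp

text \<open>Removing the lowest digit lowers the degree bound by \<open>degree P\<close>. Once
  \<open>n \<le> degree P\<close> a single digit is left, and the ordering by degree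
  decides.\<close>

lemma b_degree_less:
  assumes "k < CARD('a) ^ n"
  shows "degree (b k) < n \<or> b k = 0"
  using assms
proof (induction n arbitrary: k rule: less_induct)
  case (less n)
  show ?case
  proof (cases "n \<le> degree P")
    case True
    have "CARD('a) ^ n \<le> N"
      using True two_le_card by (intro power_increasing) auto
    with less.prems have "k < N" by simp
    then have "b k = \<beta> k"
      using b_rec[of k] b_rec[of 0] digit_0 by (simp add: digit_poly_def Let_def)
    then show ?thesis using digit_degree_less[OF True less.prems] by simp
  next
    case False
    then have n: "n - degree P < n" "n = (n - degree P) + degree P" using degree_P_pos by auto
    have "k < CARD('a) ^ (n - degree P) * N"
      using less.prems by (subst (asm) n(2)) (simp only: power_add)
    then have "k div N < CARD('a) ^ (n - degree P)"
      by (rule less_mult_imp_div_less)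
    from less.IH[OF n(1) this]
    have "degree (P * b (k div N)) < n"
      using degree_mult_le[of P "b (k div N)"] n False degree_P_pos by auto
    moreover have "degree (\<beta> (k mod N)) < n"
      using digit_degree[of "k mod N"] two_le_N False by simp
    ultimately show ?thesis by (subst (1) b_rec) (simp add: degree_add_less)
  qed
qed

text \<open>A modulus \<open>N ^ t\<close> exceeding both indices separates them.\<close>

lemma b_inj: "inj b"
proof (rule injI)
  fix j k assume eq: "b j = b k"
  have "j < N ^ (max j k)" "k < N ^ (max j k)"
    using less_N_power[of "max j k"] by auto
  moreover have "j mod N ^ max j k = k mod N ^ max j k"
    using b_cong_iff[of "max j k" j k] eq by simp
  ultimately show "j = k" by simp
qed

lemma b_bij: "bij_betw b {..<CARD('a) ^ n} {h. degree h < n \<or> h = 0}"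
proof -
  have inj: "inj_on b {..<CARD('a) ^ n}" using b_inj by (rule inj_on_subset) simp
  moreover have "b ` {..<CARD('a) ^ n} = {h. degree h < n \<or> h = 0}"
  proof (rule card_subset_eq)
    show "b ` {..<CARD('a) ^ n} \<subseteq> {h. degree h < n \<or> h = 0}"
      using b_degree_less by auto
    show "card (b ` {..<CARD('a) ^ n}) = card {h :: 'a poly. degree h < n \<or> h = 0}"
      using inj by (simp add: card_image card_poly_degree_less)
  qed (rule card_poly_degree_less)
  ultimately show ?thesis by (simp add: bij_betw_def)
qed

subsection \<open>Integrality and differences of the Wagner polynomials\<close>

text \<open>The numerator of the Wagner polynomial at \<open>h\<close>; its value at
  \<open>b k\<close> is the denominator.\<close>

definition node_prod :: "nat \<Rightarrow> 'a poly \<Rightarrow> 'a poly"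
  where "node_prod k h = (\<Prod>j<k. h - b j)"

text \<open>The analogue of Legendre's formula for the valuation of a factorial: this is the
  valuation at \<open>P\<close> of the denominator. Terms with \<open>t > k\<close> would vanish,
  since \<open>k < N ^ t\<close>.\<close>

definition order_at :: "nat \<Rightarrow> nat"
  where "order_at k = (\<Sum>t=1..k. k div N ^ t)"

text \<open>Replacing \<open>h\<close> by \<open>x j\<close> in a factor does not affect
  divisibility by \<open>P ^ t\<close> for \<open>t \<le> m\<close>. The point \<open>x j\<close>
  may vary with \<open>j\<close>, so that products mixing two arguments are covered.\<close>

lemma power_dvd_prod_diff:
  assumes "finite J" "\<And>j. j \<in> J \<Longrightarrow> P ^ m dvd x j - h"
  shows "P ^ (\<Sum>t=1..m. card {j\<in>J. P ^ t dvd h - b j}) dvd (\<Prod>j\<in>J. x j - b j)"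
proof -
  have eq: "P ^ t dvd h - b j \<longleftrightarrow> P ^ t dvd x j - b j" if "j \<in> J" "t \<le> m" for j t
  proof -
    have "P ^ t dvd x j - h" using assms(2)[OF that(1)] that(2) by (rule power_le_dvd)
    then show ?thesis using dvd_add_right_iff[of "P ^ t" "x j - h" "h - b j"] by simp
  qed
  have "(\<Sum>t=1..m. card {j\<in>J. P ^ t dvd h - b j}) =
      (\<Sum>j\<in>J. card {t\<in>{1..m}. P ^ t dvd h - b j})"
    using assms(1) by (intro sum_card_swap) simp_all
  also have "\<dots> = (\<Sum>j\<in>J. card {t\<in>{1..m}. P ^ t dvd x j - b j})"
    using eq by (intro sum.cong refl arg_cong[of _ _ card]) auto
  finally show ?thesis
    by (simp only: power_sum) (intro prod_dvd_prod power_card_dvd(1))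
qed

text \<open>Modulo \<open>P ^ t\<close> the polynomial \<open>h\<close> agrees with some
  \<open>b c\<close>, and then every index congruent to \<open>c\<close> modulo \<open>N ^ t\<close>
  contributes.\<close>

lemma card_dvd_diff_b_ge: "k div N ^ t \<le> card {j\<in>{..<k}. P ^ t dvd h - b j}"
proof -
  obtain c where c: "c < N ^ t" "P ^ t dvd h - b c" using ex_b_cong by blast
  have "P ^ t dvd h - b j" if "j mod N ^ t = c" for j
  proof -
    have "P ^ t dvd b c - b j" using that c(1) by (auto simp: b_cong_iff)
    from dvd_add[OF c(2) this] show ?thesis by simp
  qed
  then have "card {j. j < k \<and> j mod N ^ t = c} \<le> card {j\<in>{..<k}. P ^ t dvd h - b j}"
    by (intro card_mono) auto
  with card_lessThan_mod_ge[OF c(1), of k] show ?thesis by simp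
qed

lemma order_at_eq:
  assumes "k < N ^ Suc m"
  shows "order_at k = (\<Sum>t=1..m. k div N ^ t)"
proof -
  have z: "k div N ^ t = 0" if "t \<notin> {1..min k m}" "t \<ge> 1" for t
  proof -
    have "k < N ^ t"
    proof (cases "t \<le> m")
      case True
      then have "k \<le> t" using that by auto
      then show ?thesis using less_N_power[of t] by simp
    next
      case False
      then have "N ^ Suc m \<le> N ^ t" using two_le_N by (intro power_increasing) auto
      with assms show ?thesis by simp
    qed
    then show ?thesis by simp
  qed
  have "(\<Sum>t=1..k. k div N ^ t) = (\<Sum>t=1..min k m. k div N ^ t)"
    using z by (intro sum.mono_neutral_right) (auto simp del: div_eq_0_iff)
  also have "\<dots> = (\<Sum>t=1..m. k div N ^ t)"
    using z by (intro sum.mono_neutral_left) (auto simp del: div_eq_0_iff)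
  finally show ?thesis unfolding order_at_def .
qed

text \<open>Integrality of the Wagner polynomials at \<open>P\<close>: no numerator has smaller
  valuation than the denominator.\<close>

lemma power_order_at_dvd: "P ^ order_at k dvd node_prod k h"
proof -
  have "order_at k \<le> (\<Sum>t=1..k. card {j\<in>{..<k}. P ^ t dvd h - b j})"
    unfolding order_at_def by (intro sum_mono card_dvd_diff_b_ge)
  then have "P ^ order_at k dvd P ^ (\<Sum>t=1..k. card {j\<in>{..<k}. P ^ t dvd h - b j})"
    by (rule le_imp_power_dvd)
  also have "\<dots> dvd node_prod k h"
    unfolding node_prod_def by (rule power_dvd_prod_diff) simp_all
  finally show ?thesis .
qed

text \<open>At \<open>h = b k\<close> the count of each residue class is exact, so the lower bound
  for the valuation is attained.\<close>

lemma node_prod_self: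
  obtains u where "node_prod k (b k) = P ^ order_at k * u" "\<not> P dvd u"
proof -
  define c where "c j = card {t\<in>{1..k}. P ^ t dvd b k - b j}" for j
  \<comment> \<open>Distinct indices below \<open>N ^ Suc k\<close> stay distinct modulo it, so
    every factor has valuation at most \<open>k\<close> and cutting off at \<open>k\<close> loses
    nothing.\<close>
  have "P ^ c j dvd b k - b j \<and> \<not> P ^ Suc (c j) dvd b k - b j" if "j \<in> {..<k}" for j
  proof -
    have "j < N ^ Suc k" "k < N ^ Suc k"
      using that less_N_power[of "Suc k"] by auto
    then have "\<not> P ^ Suc k dvd b k - b j" using that by (simp only: b_cong_iff) simp
    then show ?thesis unfolding c_def using power_card_dvd by blast
  qed
  then obtain u where "node_prod k (b k) = P ^ sum c {..<k} * u" "\<not> P dvd u"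
    unfolding node_prod_def by (rule prod_eq_power_times[OF prime_P finite_lessThan])
  moreover have "sum c {..<k} = order_at k"
  proof -
    have eq: "{j\<in>{..<k}. P ^ t dvd b k - b j} = {j. j < k \<and> j mod N ^ t = k mod N ^ t}" for t
      by (auto simp: b_cong_iff)
    have "sum c {..<k} = (\<Sum>t=1..k. card {j\<in>{..<k}. P ^ t dvd b k - b j})"
      unfolding c_def by (rule sum_card_swap) simp_all
    also have "\<dots> = order_at k"
      unfolding order_at_def eq using two_le_N by (intro sum.cong refl card_lessThan_mod_eq) simp
    finally show ?thesis .
  qed
  ultimately show thesis by (intro that[of u]) simp_all
qed

text \<open>
  Replacing \<open>h2\<close> by \<open>h1\<close> in one factor at a time, each step changes the product by \<open>h1 - h2\<close>
  times a product with one factor missing, and a missing factor costs at most \<open>P ^ m\<close>.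
\<close>

lemma power_dvd_node_prod_diff:
  assumes "N ^ m \<le> k" "k < N ^ Suc m" "P ^ s dvd h1 - h2"
  shows "P ^ (order_at k + s) dvd P ^ m * (node_prod k h1 - node_prod k h2)"
proof (cases "s \<le> m")
  case True
  \<comment> \<open>Here \<open>P ^ m\<close> supplies the factor \<open>P ^ s\<close> by
    itself.\<close>
  have "P ^ order_at k dvd node_prod k h1 - node_prod k h2"
    using power_order_at_dvd by (intro dvd_diff)
  with True show ?thesis
    by (subst add.commute, subst power_add) (intro mult_dvd_mono le_imp_power_dvd)
next
  case False
  define z where "z i j = (if j < i then h1 else h2)" for i j :: nat
  have main: "P ^ (order_at k + s) dvd P ^ m * ((h1 - h2) * (\<Prod>j\<in>{..<k} - {i}. z i j - b j))"
    if "i < k" for i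
  proof -
    define A where "A t = card {j\<in>{..<k} - {i}. P ^ t dvd h2 - b j}" for t
    have dvd: "P ^ m dvd h1 - h2" using assms(3) False by (auto intro: power_le_dvd)
    have "P ^ sum A {1..m} dvd (\<Prod>j\<in>{..<k} - {i}. z i j - b j)"
      unfolding A_def by (rule power_dvd_prod_diff) (auto simp: z_def dvd)
    moreover have "order_at k \<le> m + sum A {1..m}"
    proof -
      \<comment> \<open>Omitting index \<open>i\<close> costs at most one in each count. Only the
        exponents \<open>1..m\<close> enter \<open>order_at k\<close>, as
        \<open>k < N ^ Suc m\<close>, so the total loss is at most \<open>m\<close>.\<close>
      have "k div N ^ t \<le> 1 + A t" for t
      proof -
        have "card {j\<in>{..<k}. P ^ t dvd h2 - b j} \<le>
            card (insert i {j\<in>{..<k} - {i}. P ^ t dvd h2 - b j})"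
          by (intro card_mono) auto
        also have "\<dots> \<le> 1 + A t" unfolding A_def by (simp add: card_insert_if)
        finally show ?thesis using card_dvd_diff_b_ge[of k t h2] by simp
      qed
      then have "(\<Sum>t=1..m. k div N ^ t) \<le> (\<Sum>t=1..m. 1 + A t)" by (rule sum_mono)
      then show ?thesis by (simp only: order_at_eq[OF assms(2)] sum.distrib) simp
    qed
    ultimately have "P ^ order_at k dvd P ^ m * (\<Prod>j\<in>{..<k} - {i}. z i j - b j)"
      using dvd_trans[OF le_imp_power_dvd[of "order_at k" "m + sum A {1..m}" P]]
      by (simp add: power_add mult_dvd_mono)
    from mult_dvd_mono[OF this assms(3)] show ?thesis
      by (simp only: power_add mult_ac)
  qed
  have "P ^ (order_at k + s) dvd P ^ m * ((\<Prod>j<k. z i j - b j) - node_prod k h2)" if "i \<le> k" for i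
    using that
  proof (induction i)
    case 0
    then show ?case by (simp add: z_def node_prod_def)
  next
    case (Suc i)
    have ik: "i \<in> {..<k}" using Suc.prems by simp
    have same: "(\<Prod>j\<in>{..<k} - {i}. z (Suc i) j - b j) = (\<Prod>j\<in>{..<k} - {i}. z i j - b j)"
      by (rule prod.cong) (auto simp: z_def)
    have "(\<Prod>j<k. z (Suc i) j - b j) - (\<Prod>j<k. z i j - b j) =
        (h1 - h2) * (\<Prod>j\<in>{..<k} - {i}. z i j - b j)"
      by (simp only: prod.remove[OF finite_lessThan ik] same) (simp add: z_def algebra_simps)
    then have "(\<Prod>j<k. z (Suc i) j - b j) - node_prod k h2 =
        ((\<Prod>j<k. z i j - b j) - node_prod k h2) +
        (h1 - h2) * (\<Prod>j\<in>{..<k} - {i}. z i j - b j)"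
      by (simp add: algebra_simps)
    then show ?case
      using Suc.IH Suc.prems main[of i] by (simp only: distrib_left) simp
  qed
  from this[of k] show ?thesis by (simp add: z_def node_prod_def)
qed

text \<open>Multiplication by \<open>u\<close> permutes the \<open>N ^ e\<close> residue classes
  represented by \<open>b\<close>: it is injective by cancellation, hence surjective, and so reaches
  the class of 1.\<close>

lemma ex_inverse_mod_power:
  assumes "\<not> P dvd u"
  shows "\<exists>v. P ^ e dvd u * v - 1"
proof -
  have "\<forall>j. \<exists>i. i < N ^ e \<and> P ^ e dvd u * b j - b i"
    using ex_b_cong by blast
  from choice[OF this] obtain f where f: "\<And>j. f j < N ^ e \<and> P ^ e dvd u * b j - b (f j)"
    by blast
  have "inj_on f {..<N ^ e}"
  proof (rule inj_onI)
    fix i j assume ij: "i \<in> {..<N ^ e}" "j \<in> {..<N ^ e}" "f i = f j"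
    have "P ^ e dvd (u * b i - b (f i)) - (u * b j - b (f j))"
      by (intro dvd_diff conjunct2[OF f])
    then have "P ^ e dvd u * (b i - b j)" using ij(3) by (simp add: algebra_simps)
    then have "P ^ e dvd b i - b j"
      using prime_elem_power_dvd_mult_cancel[OF prime_P assms] by blast
    with ij(1,2) show "i = j" by (simp add: b_cong_iff)
  qed
  with f have surj: "f ` {..<N ^ e} = {..<N ^ e}" by (intro endo_inj_surj) auto
  obtain c where c: "c < N ^ e" "P ^ e dvd 1 - b c" using ex_b_cong by blast
  then have "c \<in> f ` {..<N ^ e}" using surj by simp
  then obtain j where "f j = c" by blast
  with f[of j] have "P ^ e dvd u * b j - b c" by simp
  from dvd_diff[OF this c(2)]
  have "P ^ e dvd u * b j - 1" by (simp add: algebra_simps)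
  then show ?thesis by blast
qed

lemma node_prod_self_div: "\<not> P dvd node_prod k (b k) div P ^ order_at k"
proof -
  obtain u where "node_prod k (b k) = P ^ order_at k * u" "\<not> P dvd u"
    by (rule node_prod_self)
  then show ?thesis using P_nonzero by simp
qed

text \<open>An inverse modulo \<open>P ^ e\<close> of the part of the denominator prime to
  \<open>P\<close>.\<close>

definition lead_inverse :: "nat \<Rightarrow> nat \<Rightarrow> 'a poly"
  where "lead_inverse e k = (SOME v. P ^ e dvd node_prod k (b k) div P ^ order_at k * v - 1)"

lemma lead_inverse: "P ^ e dvd node_prod k (b k) div P ^ order_at k * lead_inverse e k - 1"
  unfolding lead_inverse_def
  by (rule someI_ex) (rule ex_inverse_mod_power[OF node_prod_self_div])

text \<open>A polynomial representing the reduction modulo \<open>P ^ e\<close> of the Wagner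
  polynomial's value at \<open>h\<close>: the common power of \<open>P\<close> is cancelled and the
  remaining denominator inverted.\<close>

definition wagner_rep :: "nat \<Rightarrow> nat \<Rightarrow> 'a poly \<Rightarrow> 'a poly"
  where "wagner_rep e k h = lead_inverse e k * (node_prod k h div P ^ order_at k)"

lemma wagner_rep_self: "P ^ e dvd wagner_rep e k (b k) - 1"
  using lead_inverse by (simp add: wagner_rep_def mult.commute)

lemma wagner_rep_less:
  assumes "j < k"
  shows "wagner_rep e k (b j) = 0"
proof -
  have "node_prod k (b j) = 0" unfolding node_prod_def using assms by (auto simp: prod_zero_iff)
  then show ?thesis by (simp add: wagner_rep_def)
qed

lemma power_dvd_wagner_rep_diff:
  assumes "N ^ m \<le> k" "k < N ^ Suc m" "P ^ s dvd h1 - h2"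
  shows "P ^ s dvd P ^ m * (wagner_rep e k h1 - wagner_rep e k h2)"
proof -
  define g where "g h = node_prod k h div P ^ order_at k" for h
  have g: "node_prod k h = P ^ order_at k * g h" for h
    unfolding g_def using power_order_at_dvd by simp
  have "P ^ order_at k * P ^ s dvd P ^ order_at k * (P ^ m * (g h1 - g h2))"
    using power_dvd_node_prod_diff[OF assms] by (simp add: g power_add algebra_simps)
  then have "P ^ s dvd P ^ m * (g h1 - g h2)" using P_nonzero by simp
  then have "P ^ s dvd lead_inverse e k * (P ^ m * (g h1 - g h2))" by simp
  then show ?thesis by (simp add: wagner_rep_def g_def[symmetric] algebra_simps)
qed

text \<open>After cancelling \<open>P ^ order_at k\<close> the value is a fraction with denominator
  prime to \<open>P\<close>. From here on the fraction field is replaced by polynomials.\<close>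

lemma reduce_mod_wagner_poly:
  "reduce_mod P e (poly (wagner_poly \<beta> P k) (to_fract h)) = residue_class (P ^ e) (wagner_rep e k h)"
proof -
  define g where "g h = node_prod k h div P ^ order_at k" for h
  have g: "node_prod k h = P ^ order_at k * g h" for h
    unfolding g_def using power_order_at_dvd by simp
  have ndvd: "\<not> P dvd g (b k)" unfolding g_def by (rule node_prod_self_div)
  then have nz: "g (b k) \<noteq> 0" by auto
  have "poly (wagner_poly \<beta> P k) (to_fract h) = to_fract (node_prod k h) / to_fract (node_prod k (b k))"
    by (simp add: wagner_poly_def node_prod_def to_fract_prod poly_prod)
  also have "\<dots> = Fract (g h) (g (b k))"
    using nz P_nonzero by (simp add: g to_fract_def eq_fract)
  finally have eq: "poly (wagner_poly \<beta> P k) (to_fract h) = Fract (g h) (g (b k))" .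
  have "P ^ e dvd (g (b k) * lead_inverse e k - 1) * g h"
    using lead_inverse[of e k] by (simp add: g_def)
  then have "[g (b k) * wagner_rep e k h = g h] (mod P ^ e)"
    by (simp add: cong_iff_dvd_diff wagner_rep_def g_def[symmetric] algebra_simps)
  then show ?thesis
    unfolding eq using reduce_mod_Fract[OF irreducible_P ndvd] by blast
qed

end

subsection \<open>Residue class rings of polynomials\<close>

lemma ideal_PIdl_poly:
  "ideal (PIdl\<^bsub>ring_of_type_algebra\<^esub> f) (ring_of_type_algebra :: 'a::field poly ring)"
  by (rule cring.cgenideal_ideal[OF cring_from_type_algebra]) (simp add: ring_of_type_algebra_def)

lemma ring_residue_ring_poly: "ring (residue_ring_poly f)"
  unfolding residue_ring_poly_def by (rule ideal.quotient_is_ring[OF ideal_PIdl_poly])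

lemma residue_class_ring_hom:
  "residue_class f \<in> ring_hom ring_of_type_algebra (residue_ring_poly f)"
proof -
  have "residue_class f = (+>\<^bsub>ring_of_type_algebra\<^esub>) (PIdl\<^bsub>ring_of_type_algebra\<^esub> f)"
    by (rule ext) (simp add: residue_class_def)
  then show ?thesis
    unfolding residue_ring_poly_def using ideal.rcos_ring_hom[OF ideal_PIdl_poly] by simp
qed

lemma carrier_residue_ring_poly: "carrier (residue_ring_poly f) = range (residue_class f)"
  by (auto simp: residue_ring_poly_def FactRing_def A_RCOSETS_def' residue_class_def
      ring_of_type_algebra_def)

lemma residue_class_mult:
  "residue_class f a \<otimes>\<^bsub>residue_ring_poly f\<^esub> residue_class f b = residue_class f (a * b)"
  using ring_hom_mult[OF residue_class_ring_hom[of f], of a b] by (simp add: ring_of_type_algebra_def)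

lemma residue_class_add:
  "residue_class f a \<oplus>\<^bsub>residue_ring_poly f\<^esub> residue_class f b = residue_class f (a + b)"
  using ring_hom_add[OF residue_class_ring_hom[of f], of a b] by (simp add: ring_of_type_algebra_def)

lemma residue_class_0: "residue_class f 0 = \<zero>\<^bsub>residue_ring_poly f\<^esub>"
  using ring_hom_zero[OF residue_class_ring_hom[of f] ring_from_type_algebra ring_residue_ring_poly]
  by (simp add: ring_of_type_algebra_def)

lemma residue_class_sum:
  assumes "finite A"
  shows "(\<Oplus>\<^bsub>residue_ring_poly f\<^esub>k\<in>A. residue_class f (F k)) = residue_class f (\<Sum>k\<in>A. F k)"
proof -
  interpret ring "residue_ring_poly f" by (rule ring_residue_ring_poly)
  show ?thesis
    using assms
    by (induction A rule: finite_induct)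
      (simp_all add: residue_class_0 residue_class_add carrier_residue_ring_poly)
qed

lemma residue_class_eq_iff: "residue_class f a = residue_class f b \<longleftrightarrow> f dvd a - b"
proof
  assume "residue_class f a = residue_class f b"
  then have "a \<in> residue_class f b" by (simp flip: \<open>residue_class f a = _\<close> add: mem_residue_class_iff)
  then show "f dvd a - b" by (simp add: mem_residue_class_iff cong_iff_dvd_diff)
next
  assume "f dvd a - b"
  then have "[a = b] (mod f)" by (simp add: cong_iff_dvd_diff)
  then show "residue_class f a = residue_class f b"
    unfolding set_eq_iff mem_residue_class_iff by (meson cong_trans cong_sym)
qed

lemma residue_class_in_PIdl_iff:
  "residue_class f a \<in> PIdl\<^bsub>residue_ring_poly f\<^esub> (residue_class f c) \<longleftrightarrow> (\<exists>x. f dvd a - x * c)"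
  unfolding cgenideal_def carrier_residue_ring_poly
  by (auto simp flip: residue_class_eq_iff residue_class_mult)

text \<open>Elements of one class modulo \<open>f\<close> are congruent modulo its divisor
  \<open>h\<close>, so any pair of members decides.\<close>

lemma class_cong_residue_class:
  assumes "h dvd f"
  shows "class_cong h (residue_class f a) (residue_class f b) \<longleftrightarrow> [a = b] (mod h)"
proof
  assume "class_cong h (residue_class f a) (residue_class f b)"
  then show "[a = b] (mod h)" by (simp add: class_cong_def mem_residue_class_iff)
next
  assume ab: "[a = b] (mod h)"
  have "[u = v] (mod h)" if "[u = a] (mod f)" "[v = b] (mod f)" for u v
    using cong_dvd_modulus[OF that(1) assms] cong_dvd_modulus[OF that(2) assms] ab
    by (meson cong_trans cong_sym)
  then show "class_cong h (residue_class f a) (residue_class f b)"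
    by (simp add: class_cong_def mem_residue_class_iff)
qed

lemma representatives_eq: "representatives f = {h. degree h < degree f \<or> h = 0}"
  by (auto simp: representatives_def)

lemma representative_residue_class:
  assumes "degree f > 0" "h \<in> representatives f"
  shows "representative f (residue_class f h) = h"
  unfolding representative_def
proof (rule the_equality)
  fix h' assume h': "h' \<in> representatives f \<and> residue_class f h' = residue_class f h"
  then have "f dvd h' - h" by (simp add: residue_class_eq_iff)
  moreover have "degree (h' - h) < degree f"
    using assms h' by (intro degree_diff_less) (auto simp: representatives_def)
  ultimately show "h' = h" using dvd_imp_degree_le[of f "h' - h"] by auto
qed (use assms in simp)

lemma carrier_residue_ring_poly_representatives:
  assumes "degree f > 0"
  shows "carrier (residue_ring_poly f) = residue_class f ` representatives f"
proof -
  have f: "f \<noteq> 0" using assms by auto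
  have "residue_class f h = residue_class f (h mod f)" "h mod f \<in> representatives f" for h
    using degree_mod_less[OF f, of h]
    by (auto simp: residue_class_eq_iff representatives_def minus_mod_eq_mult_div)
  then show ?thesis unfolding carrier_residue_ring_poly by blast
qed

subsection \<open>Interpolation\<close>

text \<open>Forward substitution: the new coefficient is the defect at the new point, and the
  earlier equations are untouched because \<open>Q M\<close> vanishes there.\<close>

lemma ex_triangular_solution:
  fixes Q :: "nat \<Rightarrow> nat \<Rightarrow> 'a::comm_ring_1"
  assumes "\<And>k. g dvd Q k k - 1" "\<And>i k. i < k \<Longrightarrow> Q k i = 0"
  shows "\<exists>c. \<forall>i<M. g dvd s i - (\<Sum>k<M. c k * Q k i)"
proof (induction M)
  case (Suc M)
  then obtain c where c: "\<And>i. i < M \<Longrightarrow> g dvd s i - (\<Sum>k<M. c k * Q k i)" by blast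
  define a where "a = s M - (\<Sum>k<M. c k * Q k M)"
  have sum: "(\<Sum>k<Suc M. (c(M := a)) k * Q k i) = (\<Sum>k<M. c k * Q k i) + a * Q M i" for i
    by simp
  have "g dvd s i - (\<Sum>k<Suc M. (c(M := a)) k * Q k i)" if "i < Suc M" for i
  proof (cases "i = M")
    case True
    \<comment> \<open>The diagonal entry is 1 only modulo \<open>g\<close>, which leaves this
      multiple of \<open>Q M M - 1\<close>.\<close>
    have "s i - (\<Sum>k<Suc M. (c(M := a)) k * Q k i) = - a * (Q M M - 1)"
      unfolding sum True by (simp add: a_def algebra_simps)
    then show ?thesis using dvd_mult[OF assms(1)[of M]] by simp
  next
    case False
    with that have "i < M" by simp
    then show ?thesis unfolding sum using c assms(2)[of i M] by simp
  qed
  then show ?case by blast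
qed simp

lemma triangular_solution_unique:
  fixes Q :: "nat \<Rightarrow> nat \<Rightarrow> 'a::comm_ring_1"
  assumes "\<And>k. g dvd Q k k - 1" "\<And>i k. i < k \<Longrightarrow> Q k i = 0"
    and "\<And>i. i < M \<Longrightarrow> g dvd (\<Sum>k<M. c k * Q k i)" and "i < M"
  shows "g dvd c i"
  using assms(4)
proof (induction i rule: less_induct)
  case (less i)
  have "g dvd c k * Q k i" if "k \<in> {..<M} - {i}" for k
  proof (cases "k < i")
    case True
    then show ?thesis using less.IH[of k] less.prems by simp
  next
    case False
    then show ?thesis using that assms(2)[of i k] by simp
  qed
  then have "g dvd (\<Sum>k\<in>{..<M} - {i}. c k * Q k i)" by (rule dvd_sum)
  moreover have "(\<Sum>k<M. c k * Q k i) = c i * Q i i + (\<Sum>k\<in>{..<M} - {i}. c k * Q k i)"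
    using less.prems by (intro sum.remove) simp_all
  ultimately have "g dvd c i * Q i i"
    using assms(3)[OF less.prems] by (simp add: dvd_add_left_iff)
  then have "g dvd c i * Q i i - c i * (Q i i - 1)"
    by (intro dvd_diff[OF _ dvd_mult[OF assms(1)]])
  then show ?case by (simp add: algebra_simps)
qed

text \<open>Dividing by \<open>d\<close> changes the base of the logarithm from \<open>q\<close> to
  \<open>q ^ d\<close>; the floor is then the position of the leading digit of \<open>k\<close> in
  base \<open>q ^ d\<close>.\<close>

lemma floor_log_div_bounds:
  fixes q d k :: nat
  assumes "q \<ge> 2" "d \<ge> 1" "k \<ge> 1"
  defines "m \<equiv> nat \<lfloor>log (real q) (real k) / real d\<rfloor>"
  shows "(q ^ d) ^ m \<le> k" "k < (q ^ d) ^ Suc m"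
proof -
  have q: "q ^ d \<ge> 2" using assms(1,2) power_increasing[of 1 d q] by simp
  have log: "log (real q) (real k) / real d = log (real (q ^ d)) (real k)"
    using assms(1) by (simp add: log_base_pow)
  have "log (real q) (real k) / real d \<ge> 0" using assms by simp
  then have "\<lfloor>log (real (q ^ d)) (real k)\<rfloor> = int m"
    unfolding m_def by (simp only: log) simp
  then have "(q ^ d) ^ m \<le> k \<and> k < (q ^ d) ^ (m + 1)"
    using floor_log_nat_eq_powr_iff[of "q ^ d" k m] q assms(3) by simp
  then show "(q ^ d) ^ m \<le> k" "k < (q ^ d) ^ Suc m" by simp_all
qed

section \<open>Congruence preservation in terms of the coefficients\<close>

context wagner_basis
begin

lemma wagner_rep_0_diff: "wagner_rep e 0 h1 = wagner_rep e 0 h2"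
  by (simp add: wagner_rep_def node_prod_def)

text \<open>For \<open>m \<le> e\<close> the factor \<open>P ^ m\<close> of \<open>c\<close> pays
  for the loss in the difference; for \<open>m > e\<close> already \<open>P ^ e\<close> divides
  \<open>c\<close>. The term of index 0 is constant and cancels, so \<open>c\<close> is unrestricted
  there.\<close>

lemma power_dvd_coeff_wagner_rep_diff:
  assumes "k \<ge> 1 \<Longrightarrow> N ^ m \<le> k \<and> k < N ^ Suc m \<and> P ^ min m e dvd c"
    and "s \<le> e" "P ^ s dvd h1 - h2"
  shows "P ^ s dvd c * (wagner_rep e k h1 - wagner_rep e k h2)"
proof (cases "k = 0")
  case True
  then show ?thesis using wagner_rep_0_diff[of e h1 h2] by simp
next
  case False
  with assms(1) have k: "N ^ m \<le> k" "k < N ^ Suc m" "P ^ min m e dvd c" by auto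
  show ?thesis
  proof (cases "m \<le> e")
    case True
    with k(3) obtain w where w: "c = P ^ m * w" by (auto simp: min_def)
    show ?thesis
      using dvd_mult[OF power_dvd_wagner_rep_diff[OF k(1,2) assms(3)], of w e]
      by (simp only: w mult_ac)
  next
    case False
    with k(3) have "P ^ e dvd c" by (simp add: min_def)
    then have "P ^ s dvd c" using assms(2) by (rule power_le_dvd)
    then show ?thesis by simp
  qed
qed

text \<open>
  For the forward direction, \<open>c k\<close> is isolated by comparing the values at \<open>b k\<close> and at
  \<open>b (k mod N ^ \<mu> k)\<close>: the terms of index above \<open>k\<close> vanish at both points, and those below \<open>k\<close>
  are already congruence preserving by induction.
\<close>

lemma interpolation_congruence_iff:
  assumes \<mu>: "\<And>k. k \<ge> 1 \<Longrightarrow> N ^ \<mu> k \<le> k \<and> k < N ^ Suc (\<mu> k)"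
    and interp: "\<And>h. degree h < n \<or> h = 0 \<Longrightarrow>
      P ^ e dvd S h - (\<Sum>k<CARD('a) ^ n. c k * wagner_rep e k h)"
  shows "(\<forall>h1 h2. (degree h1 < n \<or> h1 = 0) \<and> (degree h2 < n \<or> h2 = 0) \<longrightarrow>
      (\<forall>s\<le>e. P ^ s dvd h1 - h2 \<longrightarrow> P ^ s dvd S h1 - S h2)) \<longleftrightarrow>
    (\<forall>k. 1 \<le> k \<and> k < CARD('a) ^ n \<longrightarrow> P ^ min (\<mu> k) e dvd c k)"
    (is "?L \<longleftrightarrow> ?R")
proof -
  define M where "M = CARD('a) ^ n"
  define W where "W k h1 h2 = c k * (wagner_rep e k h1 - wagner_rep e k h2)" for k h1 h2
  have S: "P ^ s dvd S h1 - S h2 \<longleftrightarrow> P ^ s dvd (\<Sum>k<M. W k h1 h2)"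
    if "degree h1 < n \<or> h1 = 0" "degree h2 < n \<or> h2 = 0" "s \<le> e" for h1 h2 s
  proof -
    have "P ^ e dvd (S h1 - (\<Sum>k<M. c k * wagner_rep e k h1)) - (S h2 - (\<Sum>k<M. c k * wagner_rep e k h2))"
      unfolding M_def by (intro dvd_diff interp that)
    also have "\<dots> = (S h1 - S h2) - (\<Sum>k<M. W k h1 h2)"
      by (simp add: W_def right_diff_distrib sum_subtractf)
    finally have "P ^ s dvd (S h1 - S h2) - (\<Sum>k<M. W k h1 h2)"
      using that(3) by (rule power_le_dvd)
    then show ?thesis
      using dvd_add_right_iff[of "P ^ s" "(S h1 - S h2) - (\<Sum>k<M. W k h1 h2)" "\<Sum>k<M. W k h1 h2"]
      by simp
  qed
  show ?thesis
  proof
    assume R: ?R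
    show ?L
    proof (intro allI impI, elim conjE)
      fix h1 h2 s
      assume h: "degree h1 < n \<or> h1 = 0" "degree h2 < n \<or> h2 = 0" "s \<le> e" "P ^ s dvd h1 - h2"
      have "P ^ s dvd W k h1 h2" if "k \<in> {..<M}" for k
        unfolding W_def using \<mu>[of k] R that h(3,4)
        by (intro power_dvd_coeff_wagner_rep_diff[where m = "\<mu> k"]) (auto simp: M_def)
      then have "P ^ s dvd (\<Sum>k<M. W k h1 h2)" by (rule dvd_sum)
      then show "P ^ s dvd S h1 - S h2" using S[OF h(1,2,3)] by blast
    qed
  next
    assume L: ?L
    show ?R
    proof (intro allI impI)
      fix k assume "1 \<le> k \<and> k < CARD('a) ^ n"
      then show "P ^ min (\<mu> k) e dvd c k"
      proof (induction k rule: less_induct)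
        case (less k)
        then have k: "1 \<le> k" "k < M" by (auto simp: M_def)
        define s where "s = min (\<mu> k) e"
        \<comment> \<open>By the bounds on \<open>\<mu> k\<close>, this removes the leading digit of
          \<open>k\<close> in base \<open>N\<close>: the result is smaller than \<open>k\<close> but
          agrees with it modulo \<open>N ^ \<mu> k\<close>.\<close>
        define r where "r = k mod N ^ \<mu> k"
        have "r < N ^ \<mu> k" unfolding r_def using two_le_N by simp
        then have rk: "r < k" using \<mu>[OF k(1)] by simp
        have "P ^ \<mu> k dvd b k - b r" unfolding r_def by (simp add: b_cong_iff)
        then have s: "P ^ s dvd b k - b r" "s \<le> e"
          unfolding s_def by (auto intro: power_le_dvd)
        have reps: "degree (b k) < n \<or> b k = 0" "degree (b r) < n \<or> b r = 0"
          using b_degree_less[of k n] b_degree_less[of r n] k(2) rk by (auto simp: M_def)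
        have "P ^ s dvd S (b k) - S (b r)" using L reps s by blast
        then have sum: "P ^ s dvd (\<Sum>j<M. W j (b k) (b r))" using S[OF reps s(2)] by blast
        have "P ^ s dvd W j (b k) (b r)" if j: "j \<in> {..<M} - {k}" for j
        proof (cases "j < k")
          case True
          then show ?thesis
            unfolding W_def using \<mu>[of j] less.IH[of j] k s
            by (intro power_dvd_coeff_wagner_rep_diff[where m = "\<mu> j"]) (auto simp: M_def)
        next
          case False
          with j have "k < j" by auto
          with rk show ?thesis by (simp add: W_def wagner_rep_less)
        qed
        then have "P ^ s dvd (\<Sum>j\<in>{..<M} - {k}. W j (b k) (b r))" by (rule dvd_sum)
        moreover have "(\<Sum>j<M. W j (b k) (b r)) =
            W k (b k) (b r) + (\<Sum>j\<in>{..<M} - {k}. W j (b k) (b r))"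
          using k(2) by (intro sum.remove) simp_all
        ultimately have "P ^ s dvd W k (b k) (b r)" using sum by (simp add: dvd_add_left_iff)
        then have 1: "P ^ s dvd c k * wagner_rep e k (b k)" using rk by (simp add: W_def wagner_rep_less)
        have "P ^ s dvd wagner_rep e k (b k) - 1"
          using wagner_rep_self s(2) by (rule power_le_dvd)
        \<comment> \<open>The diagonal value is 1 modulo \<open>P ^ s\<close>, so the divisibility
          passes to the coefficient.\<close>
        from dvd_diff[OF 1 dvd_mult[OF this, of "c k"]] show ?case
          unfolding s_def by (simp add: algebra_simps)
      qed
    qed
  qed
qed

end

section \<open>Transfer to residue classes\<close>

text \<open>Every divisor of \<open>P ^ e\<close> is a power of \<open>P\<close> up to a unit, so
  testing powers suffices. \<open>S\<close> is any lift of \<open>\<sigma>\<close> to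
  polynomials.\<close>

lemma congruence_preserving_residue_class_iff:
  assumes "irreducible P" "\<And>h. \<sigma> (residue_class f h) = residue_class (P ^ e) (S h)"
  shows "congruence_preserving f (P ^ e) \<sigma> \<longleftrightarrow>
    (\<forall>h1 h2. h1 \<in> representatives f \<and> h2 \<in> representatives f \<longrightarrow>
      (\<forall>s\<le>e. P ^ s dvd h1 - h2 \<longrightarrow> P ^ s dvd S h1 - S h2))"
    (is "?L \<longleftrightarrow> ?R")
proof
  assume L: ?L
  show ?R
  proof (intro allI impI, elim conjE)
    fix h1 h2 s
    assume h: "h1 \<in> representatives f" "h2 \<in> representatives f" "s \<le> e" "P ^ s dvd h1 - h2"
    have "P ^ s dvd P ^ e" using h(3) by (rule le_imp_power_dvd)
    moreover from this have
      "class_cong (P ^ s) (\<sigma> (residue_class f h1)) (\<sigma> (residue_class f h2))"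
      using L h by (simp add: congruence_preserving_def cong_iff_dvd_diff)
    ultimately show "P ^ s dvd S h1 - S h2"
      by (simp add: assms(2) class_cong_residue_class cong_iff_dvd_diff)
  qed
next
  assume R: ?R
  show ?L
    unfolding congruence_preserving_def
  proof (intro ballI allI impI)
    fix h1 h2 h
    assume h: "h1 \<in> representatives f" "h2 \<in> representatives f" "h dvd P ^ e" "[h1 = h2] (mod h)"
    from field_poly_irreducible_imp_prime[OF assms(1)] h(3)
    obtain i where i: "i \<le> e" "h dvd P ^ i" "P ^ i dvd h" by (rule dvd_prime_elem_power)
    have "h dvd h1 - h2" using h(4) by (simp add: cong_iff_dvd_diff)
    with i(3) have "P ^ i dvd h1 - h2" by (rule dvd_trans)
    then have "P ^ i dvd S h1 - S h2" using R h(1,2) i(1) by blast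
    with i(2) have "h dvd S h1 - S h2" by (rule dvd_trans)
    then show "class_cong h (\<sigma> (residue_class f h1)) (\<sigma> (residue_class f h2))"
      by (simp add: assms(2) class_cong_residue_class[OF h(3)] cong_iff_dvd_diff)
  qed
qed

text \<open>For \<open>m > e\<close> the generator is the zero class, and membership means
  divisibility by \<open>P ^ e\<close>; this is where the minimum comes from.\<close>

lemma residue_class_in_PIdl_power_iff:
  "residue_class (P ^ e) a \<in> PIdl\<^bsub>residue_ring_poly (P ^ e)\<^esub> (residue_class (P ^ e) (P ^ m)) \<longleftrightarrow>
    P ^ min m e dvd a"
  unfolding residue_class_in_PIdl_iff
proof
  assume "\<exists>x. P ^ e dvd a - x * P ^ m"
  then obtain x where "P ^ e dvd a - x * P ^ m" by blast
  then have "P ^ min m e dvd a - x * P ^ m" by (rule power_le_dvd) simp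
  moreover have "P ^ min m e dvd x * P ^ m" by (intro dvd_mult le_imp_power_dvd) simp
  ultimately show "P ^ min m e dvd a"
    using dvd_add[of "P ^ min m e" "a - x * P ^ m" "x * P ^ m"] by simp
next
  assume a: "P ^ min m e dvd a"
  show "\<exists>x. P ^ e dvd a - x * P ^ m"
  proof (cases "m \<le> e")
    case True
    with a obtain x where "a = P ^ m * x" by (auto simp: min_def)
    then have "P ^ e dvd a - x * P ^ m" by simp
    then show ?thesis by blast
  next
    case False
    with a have "P ^ e dvd a - 0 * P ^ m" by (simp add: min_def)
    then show ?thesis by blast
  qed
qed

theorem theorem1p11:
  fixes f P :: "'a::{field,finite} poly"
    and \<beta> :: "nat \<Rightarrow> 'a poly"
    and \<sigma> :: "'a poly set \<Rightarrow> 'a poly set"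
    and n d e :: nat
  assumes "degree f = n" and "n \<ge> 1"
    and "irreducible P" and "degree P = d" and "d \<ge> 1"
    and "e \<ge> 1"
    and "admissible_ordering d \<beta>"
    and "\<sigma> \<in> carrier (residue_ring_poly f) \<rightarrow> carrier (residue_ring_poly (P ^ e))"
  shows "congruence_preserving f (P ^ e) \<sigma> \<longleftrightarrow>
    (\<exists>!c. c \<in> {..<CARD('a) ^ n} \<rightarrow>\<^sub>E carrier (residue_ring_poly (P ^ e)) \<and>
       (\<forall>x\<in>carrier (residue_ring_poly f).
          \<sigma> x = (\<Oplus>\<^bsub>residue_ring_poly (P ^ e)\<^esub>k\<in>{..<CARD('a) ^ n}.
                   c k \<otimes>\<^bsub>residue_ring_poly (P ^ e)\<^esub> wagner_fun \<beta> f P e k x)) \<and>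
       (\<forall>k\<in>{1..CARD('a) ^ n - 1}.
          c k \<in> PIdl\<^bsub>residue_ring_poly (P ^ e)\<^esub>
            (residue_class (P ^ e) (P ^ nat \<lfloor>log (real CARD('a)) (real k) / real d\<rfloor>))))"
    (is "_ \<longleftrightarrow> (\<exists>!c. ?ext c \<and> ?expansion c \<and> ?ideal c)")
proof -
  interpret wagner_basis \<beta> P
    using assms by unfold_locales simp_all
  define M where "M = CARD('a) ^ n"
  define \<mu> where "\<mu> k = nat \<lfloor>log (real CARD('a)) (real k) / real d\<rfloor>" for k
  have \<mu>: "N ^ \<mu> k \<le> k \<and> k < N ^ Suc (\<mu> k)" if "k \<ge> 1" for k
    unfolding \<mu>_def assms(4) using floor_log_div_bounds[OF two_le_card assms(5) that] by blast
  have reps: "representatives f = {h. degree h < n \<or> h = 0}"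
    by (simp add: representatives_eq assms(1))
  have f_pos: "degree f > 0" using assms(1,2) by simp
  have "\<exists>g. \<sigma> (residue_class f h) = residue_class (P ^ e) g" for h
    using assms(8) by (auto simp: carrier_residue_ring_poly)
  then obtain S where S: "\<And>h. \<sigma> (residue_class f h) = residue_class (P ^ e) (S h)"
    by metis
  define Q where "Q k i = wagner_rep e k (b i)" for k i
  have Q_diag: "P ^ e dvd Q k k - 1" for k
    unfolding Q_def by (rule wagner_rep_self)
  have Q_less: "Q k i = 0" if "i < k" for i k
    unfolding Q_def using that by (rule wagner_rep_less)
  have reps_b: "representatives f = b ` {..<M}"
    unfolding reps M_def by (rule bij_betw_imp_surj_on[OF b_bij, symmetric])
  \<comment> \<open>Since \<open>b\<close> enumerates the representatives, the expansion becomes a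
    triangular system of \<open>M\<close> congruences for lifted coefficients.\<close>
  have expansion: "?expansion c \<longleftrightarrow> (\<forall>i<M. P ^ e dvd S (b i) - (\<Sum>k<M. C k * Q k i))"
    if c: "\<forall>k<M. c k = residue_class (P ^ e) (C k)" for c C
  proof -
    have sum: "(\<Oplus>\<^bsub>residue_ring_poly (P ^ e)\<^esub>k\<in>{..<M}.
          c k \<otimes>\<^bsub>residue_ring_poly (P ^ e)\<^esub> wagner_fun \<beta> f P e k (residue_class f h)) =
        residue_class (P ^ e) (\<Sum>k<M. C k * wagner_rep e k h)"
      if "h \<in> representatives f" for h
    proof -
      interpret R: ring "residue_ring_poly (P ^ e)" by (rule ring_residue_ring_poly)
      have "c k \<otimes>\<^bsub>residue_ring_poly (P ^ e)\<^esub> wagner_fun \<beta> f P e k (residue_class f h) =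
          residue_class (P ^ e) (C k * wagner_rep e k h)" if "k < M" for k
        using c that by (simp add: wagner_fun_def residue_class_mult
            representative_residue_class[OF f_pos \<open>h \<in> representatives f\<close>] reduce_mod_wagner_poly)
      then have "(\<Oplus>\<^bsub>residue_ring_poly (P ^ e)\<^esub>k\<in>{..<M}.
          c k \<otimes>\<^bsub>residue_ring_poly (P ^ e)\<^esub> wagner_fun \<beta> f P e k (residue_class f h)) =
        (\<Oplus>\<^bsub>residue_ring_poly (P ^ e)\<^esub>k\<in>{..<M}. residue_class (P ^ e) (C k * wagner_rep e k h))"
        by (intro R.finsum_cong') (auto simp: carrier_residue_ring_poly)
      then show ?thesis by (simp add: residue_class_sum)
    qed
    have "?expansion c \<longleftrightarrow> (\<forall>h\<in>representatives f.
        P ^ e dvd S h - (\<Sum>k<M. C k * wagner_rep e k h))"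
      unfolding carrier_residue_ring_poly_representatives[OF f_pos] M_def[symmetric]
      by (simp add: sum S residue_class_eq_iff)
    also have "\<dots> \<longleftrightarrow> (\<forall>i<M. P ^ e dvd S (b i) - (\<Sum>k<M. C k * Q k i))"
      unfolding Q_def reps_b ball_simps by (simp only: Ball_def lessThan_iff)
    finally show ?thesis .
  qed
  \<comment> \<open>Given any expansion of \<open>\<sigma>\<close>, its coefficients decide whether
    \<open>\<sigma>\<close> is congruence preserving.\<close>
  have preserving: "congruence_preserving f (P ^ e) \<sigma> \<longleftrightarrow> ?ideal c"
    if c: "\<forall>k<M. c k = residue_class (P ^ e) (C k)" and "?expansion c" for c C
  proof -
    note interp = iffD1[OF expansion[of c C, OF c] \<open>?expansion c\<close>]
    have "P ^ e dvd S h - (\<Sum>k<CARD('a) ^ n. C k * wagner_rep e k h)"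
      if "degree h < n \<or> h = 0" for h
    proof -
      have "h \<in> representatives f" using that by (simp only: reps mem_Collect_eq)
      then obtain i where i: "i < M" "h = b i" unfolding reps_b by auto
      show ?thesis using interp[rule_format, OF i(1)] unfolding M_def Q_def i(2) .
    qed
    from interpolation_congruence_iff[where \<mu> = \<mu> and S = S and c = C, OF \<mu> this]
    have "congruence_preserving f (P ^ e) \<sigma> \<longleftrightarrow>
        (\<forall>k. 1 \<le> k \<and> k < M \<longrightarrow> P ^ min (\<mu> k) e dvd C k)"
      unfolding congruence_preserving_residue_class_iff[where S = S, OF assms(3) S] reps M_def
        mem_Collect_eq .
    also have "\<dots> \<longleftrightarrow> (\<forall>k\<in>{1..M - 1}. P ^ min (\<mu> k) e dvd C k)"
      by auto
    also have "\<dots> \<longleftrightarrow> (\<forall>k\<in>{1..M - 1}. c k \<in> PIdl\<^bsub>residue_ring_poly (P ^ e)\<^esub>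
            (residue_class (P ^ e) (P ^ \<mu> k)))"
      by (intro ball_cong refl) (auto simp: c residue_class_in_PIdl_power_iff)
    finally show ?thesis unfolding \<mu>_def M_def .
  qed
  have lift: "\<exists>C. \<forall>k<M. c k = residue_class (P ^ e) (C k)" if "?ext c" for c
  proof -
    have "\<exists>a. k < M \<longrightarrow> c k = residue_class (P ^ e) a" for k
      using PiE_mem[OF that, of k] unfolding carrier_residue_ring_poly M_def by auto
    then have "\<exists>C. \<forall>k. k < M \<longrightarrow> c k = residue_class (P ^ e) (C k)" by (intro choice allI)
    then show ?thesis .
  qed
  have unique: "c = c'" if ext: "?ext c" "?ext c'" and exp: "?expansion c" "?expansion c'" for c c'
  proof (rule PiE_ext[OF ext])
    fix i assume i: "i \<in> {..<CARD('a) ^ n}"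
    obtain C where C: "\<forall>k<M. c k = residue_class (P ^ e) (C k)"
      using lift[OF ext(1)] by (elim exE)
    obtain C' where C': "\<forall>k<M. c' k = residue_class (P ^ e) (C' k)"
      using lift[OF ext(2)] by (elim exE)
    \<comment> \<open>Subtracting the two systems leaves a homogeneous triangular one, whose only
      solution modulo \<open>P ^ e\<close> is zero.\<close>
    have "P ^ e dvd (\<Sum>k<M. (C k - C' k) * Q k i)" if "i < M" for i
    proof -
      have "P ^ e dvd S (b i) - (\<Sum>k<M. C k * Q k i)" "P ^ e dvd S (b i) - (\<Sum>k<M. C' k * Q k i)"
        using iffD1[OF expansion[of c C, OF C] exp(1)]
          iffD1[OF expansion[of c' C', OF C'] exp(2)] \<open>i < M\<close> by simp_all
      from dvd_diff[OF this(2,1)] show ?thesis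
        by (simp add: left_diff_distrib sum_subtractf)
    qed
    then have "P ^ e dvd C i - C' i"
      using i by (intro triangular_solution_unique[OF Q_diag Q_less, where c = "\<lambda>k. C k - C' k"])
        (auto simp: M_def)
    then show "c i = c' i" using i C C' by (simp add: M_def residue_class_eq_iff)
  qed
  show ?thesis
  proof
    assume cp: "congruence_preserving f (P ^ e) \<sigma>"
    have "\<exists>C. \<forall>i<M. P ^ e dvd S (b i) - (\<Sum>k<M. C k * Q k i)"
      by (rule ex_triangular_solution) (rule Q_diag Q_less, assumption?)+
    then obtain C where C: "\<forall>i<M. P ^ e dvd S (b i) - (\<Sum>k<M. C k * Q k i)" by (elim exE)
    \<comment> \<open>Restricting to the index range makes \<open>c\<close> extensional, as the
      function space in the statement demands.\<close>
    define c where "c = (\<lambda>k\<in>{..<CARD('a) ^ n}. residue_class (P ^ e) (C k))"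
    have c: "\<forall>k<M. c k = residue_class (P ^ e) (C k)"
      by (simp add: c_def M_def)
    have "?ext c" unfolding c_def carrier_residue_ring_poly by auto
    moreover have exp: "?expansion c" by (rule iffD2[OF expansion[of c C, OF c] C])
    moreover have "?ideal c" by (rule iffD1[OF preserving[of c C, OF c exp] cp])
    ultimately have sol: "?ext c \<and> ?expansion c \<and> ?ideal c" by (intro conjI)
    show "\<exists>!c. ?ext c \<and> ?expansion c \<and> ?ideal c"
    proof (rule ex1I[of _ c])
      show "?ext c \<and> ?expansion c \<and> ?ideal c" by (rule sol)
    next
      fix c' assume c': "?ext c' \<and> ?expansion c' \<and> ?ideal c'"
      show "c' = c"
        by (rule unique[OF conjunct1[OF c'] conjunct1[OF sol] conjunct1[OF conjunct2[OF c']] exp])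
    qed
  next
    assume "\<exists>!c. ?ext c \<and> ?expansion c \<and> ?ideal c"
    then obtain c where c: "?ext c" "?expansion c" "?ideal c" by (elim ex1E conjE)
    obtain C where "\<forall>k<M. c k = residue_class (P ^ e) (C k)"
      using lift[OF c(1)] by (elim exE)
    from iffD2[OF preserving[of c C, OF this c(2)] c(3)]
    show "congruence_preserving f (P ^ e) \<sigma>" .
  qed
qed

end
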